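(* Suppose that $q\equiv\pm1\pmod{20}$, so that $5$ is a square in $\mathbb{F}_q$. Set $c=(3-\sqrt5)/8\in\mathbb{F}_q$ for either choice of the square root $\sqrt5\in\mathbb{F}_q$. Then $c\in\mathcal{C}$, and for $s\in\mathbb{F}_q$ with $1-s^2=c$, each monic irreducible factor $I(y)$ of $g_s(y)$ over $\mathbb{F}_q$ has the form $$y^{10}-5y^9+\frac{85}{8}y^8-\frac{25}{2}y^7+\frac{2275}{256}y^6-\frac{1001}{256}y^5+\frac{2145}{2048}y^4-\frac{165}{1024}y^3+\frac{825}{65536}y^2-\frac{25}{65536}y-m$$ for some $m\in\mathbb{F}_q$.
   Context: $\mathbb{F}_q$ is a finite field with $q$ elements, $q$ a power of an odd prime; $n=(q+1)/2$; for $s\in\mathbb{F}_q$, $g_s(y) := y^n+(1-y)^n-s \in \mathbb{F}_q[y]$. $\rho$ is the quadratic character on $\mathbb{F}_q$ and $\mathcal{C} := \{a \in \mathbb{F}_q : \rho(a)=\rho(1-a)=1\}$. *)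

theory Defs
  imports
    "HOL-Computational_Algebra.Polynomial"
    "HOL-Library.Cardinality"
    "HOL-Number_Theory.Cong"
begin

text \<open>The finite field with \<open>q\<close> elements is a type \<open>'a\<close> of sort \<open>{finite, field}\<close>, with \<open>q = CARD('a)\<close>.\<close>

definition quadratic_char :: "'a::{finite,field} \<Rightarrow> int"
  where "quadratic_char a = (if a = 0 then 0 else if \<exists>b. b\<^sup>2 = a then 1 else -1)"

definition C_set :: "'a::{finite,field} set"
  where "C_set = {a. quadratic_char a = 1 \<and> quadratic_char (1 - a) = 1}"

text \<open>The polynomial \<open>y ^ n + (1 - y) ^ n - s\<close>; for odd \<open>q\<close> the division in \<open>n = (q + 1) div 2\<close> is exact.\<close>

definition g_poly :: "'a::{finite,field} \<Rightarrow> 'a poly"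
  where "g_poly s =
    (let n = (CARD('a) + 1) div 2 in [:0, 1:] ^ n + (1 - [:0, 1:]) ^ n - [:s:])"

end

theory Submission
  imports "HOL-Algebra.Algebraic_Closure_Type" Defs
begin

text \<open>
  Let \<open>F\<close> be the field. Inside its algebraic closure, write a root of \<open>g_poly s\<close> as \<open>y = u\<^sup>2\<close> with
  \<open>1 - y = v\<^sup>2\<close>, and let \<open>q = 2 n - 1\<close> be the number of elements of \<open>F\<close>. Then \<open>u ^ (q + 1) = y ^ n\<close> and
  \<open>v ^ (q + 1) = (1 - y) ^ n\<close>, so that \<open>g_poly s\<close> vanishes at \<open>y\<close> iff the point \<open>(u, v)\<close> of the
  unit circle and its Frobenius image have inner product \<open>s\<close>: the Frobenius map rotates the point
  by an angle with cosine \<open>s\<close>. For \<open>1 - s\<^sup>2 = (3 - sqrt 5) / 8\<close>, formally the square of the sine of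
  18 or 54 degrees depending on the choice of the root, the doubled angle, whose cosine is \<open>x = 2 y - 1\<close>, advances by a
  tenth of a full turn or by three tenths. Consequently the Chebyshev value \<open>T\<^sub>5 x\<close> changes its
  sign, and \<open>(T\<^sub>5 x)\<^sup>2\<close> is fixed and lies in \<open>F\<close>. The displayed polynomial of degree 10, its
  constant term apart, is \<open>(T\<^sub>5 (2 y - 1)\<^sup>2 - 1) / 2 ^ 18\<close>. So every irreducible factor of
  \<open>g_poly s\<close> divides it for a suitable \<open>m\<close>.

  The divisor is the whole polynomial because the Frobenius orbit of \<open>y\<close> has ten elements. Its
  points satisfy a three-term recurrence with antiperiod 5 as soon as the orbit is longer than 2,
  which leaves the proper divisors of 10 to be excluded. That \<open>y\<close> is not fixed by the
  second iterate is where it matters that \<open>c = 1 - s\<^sup>2\<close> is a square in \<open>F\<close>: the area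
  \<open>u v' - u' v\<close>, with \<open>u' = u ^ q\<close> and \<open>v' = v ^ q\<close>, is a nonzero square root of \<open>c\<close>, hence
  lies in \<open>F\<close>, whereas the Frobenius map would change its sign if the second iterate fixed both
  \<open>u\<close> and \<open>v\<close>. All of this is carried out with polynomial identities in \<open>y\<close>, \<open>y ^ q\<close>, \<open>y ^ n\<close> and
  \<open>(1 - y) ^ n\<close> (lemma \<open>root_orbit\<close>), which avoids choosing \<open>u\<close> and \<open>v\<close>.

  The square roots that the theorem asserts come from a primitive 20th root of unity \<open>z\<close>. As
  \<open>q\<close> is \<open>1\<close> or \<open>-1\<close> modulo 20, the Frobenius map fixes \<open>z\<close> or inverts it, so \<open>b = z + 1 / z\<close> lies
  in \<open>F\<close>, and \<open>2 b\<^sup>2 = 5 + r\<close> for a square root \<open>r\<close> of 5 (lemma \<open>sqrt5_and_cos18\<close>).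
\<close>

section \<open>The Frobenius map on the algebraic closure of a finite field\<close>

text \<open>
  Multiplication by \<open>x\<close> permutes the nonzero elements, so it leaves their product unchanged.
\<close>
lemma power_CARD_eq_same:
  fixes x :: "'a::{finite,field}"
  shows "x ^ CARD('a) = x"
proof (cases "x = 0")
  case True
  then show ?thesis by (simp add: power_0_left)
next
  case False
  let ?U = "UNIV - {0::'a}"
  have "(\<lambda>y. x * y) ` ?U = ?U"
    by (rule endo_inj_surj) (use False in \<open>auto simp: inj_on_def\<close>)
  moreover have inj: "inj_on (\<lambda>y. x * y) ?U"
    using False by (auto simp: inj_on_def)
  ultimately have "\<Prod>?U = (\<Prod>y\<in>?U. x * y)"
    using prod.reindex[OF inj, of "\<lambda>y. y"] by simp
  also have "\<dots> = x ^ card ?U * \<Prod>?U"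
    by (simp add: prod.distrib)
  finally have "x ^ card ?U = 1"
    by simp
  moreover have "CARD('a) = Suc (card ?U)"
    by (rule card.remove) auto
  ultimately show ?thesis
    by (metis power_Suc mult_1_right)
qed

text \<open>
  The polynomial \<open>(X + 1) ^ q - X ^ q - 1\<close> has degree less than \<open>q\<close> and vanishes at all \<open>q\<close>
  elements of the field, so its coefficients are zero. This gives the additivity of the
  \<open>q\<close>-th power without decomposing \<open>q\<close> into a power of the characteristic.
\<close>
lemma CARD_choose_eq_0:
  assumes "0 < i" "i < CARD('a::{finite,field})"
  shows "of_nat (CARD('a) choose i) = (0::'a)"
proof -
  let ?q = "CARD('a)"
  define P :: "'a poly" where "P = (\<Sum>j\<in>{0<..<?q}. monom (of_nat (?q choose j)) j)"
  have "poly P a = 0" for a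
  proof -
    have split: "{..?q} = insert 0 (insert ?q {0<..<?q})"
      by auto
    have "(a + 1) ^ ?q = (\<Sum>j\<le>?q. of_nat (?q choose j) * a ^ j)"
      by (simp add: binomial_ring)
    also have "\<dots> = 1 + a ^ ?q + poly P a"
      by (subst split) (simp add: P_def poly_sum poly_monom)
    finally show ?thesis
      by (simp add: power_CARD_eq_same)
  qed
  then have roots: "{a. poly P a = 0} = UNIV"
    by auto
  have "degree P \<le> ?q - 1"
    unfolding P_def by (rule degree_sum_le) (auto intro: order.trans[OF degree_monom_le])
  then have "degree P < ?q"
    using zero_less_card_finite[where 'a='a] by linarith
  then have "P = 0"
    using card_poly_roots_bound[of P] roots by fastforce
  moreover have "coeff P i = of_nat (?q choose i)"
    using assms by (simp add: P_def coeff_sum sum.delta)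
  ultimately show ?thesis
    by simp
qed

lemma one_less_CARD: "1 < CARD('a::{finite,field})"
proof -
  have "card {0, 1::'a} \<le> CARD('a)"
    by (rule card_mono[OF finite subset_UNIV])
  then show ?thesis by simp
qed

lemma of_nat_CARD_eq_0: "of_nat CARD('a) = (0::'a::{finite,field})"
  using CARD_choose_eq_0[of 1, where 'a='a] one_less_CARD[where 'a='a] by simp

definition frob :: "'a::{finite,field} alg_closure \<Rightarrow> 'a alg_closure"
  where "frob x = x ^ CARD('a)"

lemma frob_to_ac [simp]: "frob (to_ac a) = to_ac a"
  unfolding frob_def by (metis to_ac_power power_CARD_eq_same)

lemma frob_0 [simp]: "frob 0 = 0"
  by (simp add: frob_def power_0_left)

lemma frob_1 [simp]: "frob 1 = 1"
  by (simp add: frob_def)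

lemma frob_numeral [simp]: "frob (numeral k) = numeral k"
  using frob_to_ac[of "numeral k"] by simp

lemma frob_mult [simp]: "frob (x * y) = frob x * frob y"
  by (simp add: frob_def power_mult_distrib)

lemma frob_divide [simp]: "frob (x / y) = frob x / frob y"
  by (simp add: frob_def power_divide)

lemma frob_power [simp]: "frob (x ^ k) = frob x ^ k"
  unfolding frob_def by (metis power_mult mult.commute)

lemma frob_add [simp]:
  fixes x y :: "'a::{finite,field} alg_closure"
  shows "frob (x + y) = frob x + frob y"
proof -
  let ?q = "CARD('a)"
  have "(x + y) ^ ?q = (\<Sum>j\<le>?q. of_nat (?q choose j) * x ^ j * y ^ (?q - j))"
    by (rule binomial_ring)
  also have "\<dots> = (\<Sum>j\<in>{0, ?q}. of_nat (?q choose j) * x ^ j * y ^ (?q - j))"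
  proof (rule sum.mono_neutral_right)
    show "\<forall>j\<in>{..?q} - {0, ?q}. of_nat (?q choose j) * x ^ j * y ^ (?q - j) = 0"
    proof
      fix j assume "j \<in> {..?q} - {0, ?q}"
      then have "of_nat (?q choose j) = (0::'a)"
        by (intro CARD_choose_eq_0) auto
      then have "of_nat (?q choose j) = (0::'a alg_closure)"
        by (metis to_ac_of_nat to_ac_0)
      then show "of_nat (?q choose j) * x ^ j * y ^ (?q - j) = 0"
        by simp
    qed
  qed auto
  finally show ?thesis
    by (simp add: frob_def add.commute)
qed

lemma frob_diff [simp]: "frob (x - y) = frob x - frob y"
  using frob_add[of "x - y" y] by (simp add: algebra_simps)

lemma inj_frob: "inj frob"
proof (rule injI)
  fix x y :: "'a alg_closure"
  assume "frob x = frob y"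
  then have "frob (x - y) = 0"
    by simp
  then show "x = y"
    by (simp add: frob_def)
qed

text \<open>
  The \<open>q\<close> elements of the base field already exhaust the possible roots of \<open>X ^ q - X\<close>.
\<close>
lemma frob_fixed_imp_base_field:
  fixes x :: "'a::{finite,field} alg_closure"
  assumes "frob x = x"
  obtains a where "x = to_ac a"
proof -
  let ?q = "CARD('a)"
  define P :: "'a alg_closure poly" where "P = monom 1 ?q - monom 1 1"
  have q: "1 < ?q"
    by (rule one_less_CARD)
  have deg: "degree P = ?q"
    unfolding P_def by (subst diff_conv_add_uminus, subst degree_add_eq_left)
      (use q in \<open>simp_all add: degree_monom_eq\<close>)
  have roots: "poly P z = 0 \<longleftrightarrow> frob z = z" for z
    by (simp add: P_def poly_monom frob_def)
  have "P \<noteq> 0"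
    using deg q by auto
  then have fin: "finite {z. poly P z = 0}" and "card {z. poly P z = 0} \<le> ?q"
    using poly_roots_finite card_poly_roots_bound deg by fastforce+
  moreover have "card (range (to_ac :: 'a \<Rightarrow> _)) = ?q"
    by (simp add: card_image inj_to_ac)
  moreover have "range to_ac \<subseteq> {z. poly P z = 0}"
    by (auto simp: roots)
  ultimately have "range to_ac = {z. poly P z = 0}"
    by (metis card_mono card_subset_eq order.antisym)
  then show thesis
    using assms roots that by blast
qed

section \<open>Irreducible polynomials and their roots\<close>

definition eval_ac :: "'a::field poly \<Rightarrow> 'a alg_closure \<Rightarrow> 'a alg_closure"
  where "eval_ac p x = poly (map_poly to_ac p) x"

lemma eval_ac_0 [simp]: "eval_ac 0 x = 0"
  by (simp add: eval_ac_def)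

lemma eval_ac_pCons [simp]: "eval_ac (pCons a p) x = to_ac a + x * eval_ac p x"
  by (simp add: eval_ac_def map_poly_pCons)

lemma eval_ac_1 [simp]: "eval_ac 1 x = 1"
  by (simp add: eval_ac_def)

lemma eval_ac_add [simp]: "eval_ac (p + q) x = eval_ac p x + eval_ac q x"
  by (induction p q rule: poly_induct2) (simp_all add: algebra_simps)

lemma eval_ac_diff [simp]: "eval_ac (p - q) x = eval_ac p x - eval_ac q x"
  using eval_ac_add[of "p - q" q x] by (simp add: algebra_simps)

lemma eval_ac_smult [simp]: "eval_ac (smult a p) x = to_ac a * eval_ac p x"
  by (induction p) (simp_all add: algebra_simps)

lemma eval_ac_mult [simp]: "eval_ac (p * q) x = eval_ac p x * eval_ac q x"
  by (induction p) (simp_all add: algebra_simps)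

lemma eval_ac_power [simp]: "eval_ac (p ^ n) x = eval_ac p x ^ n"
  by (induction n) simp_all

lemma degree_map_poly_to_ac: "degree (map_poly to_ac p) = degree p"
  by (rule degree_map_poly) simp

lemma frob_eval_ac: "frob (eval_ac p x) = eval_ac p (frob x)"
  by (induction p) simp_all

lemma irreducible_imp_root:
  fixes p :: "'a::field poly"
  assumes "irreducible p"
  obtains x where "eval_ac p x = 0"
proof -
  have "p \<noteq> 0"
    using assms by auto
  then have "degree p \<noteq> 0"
    using is_unit_iff_degree[of p] irreducible_not_unit[OF assms] assms by auto
  then have "degree (map_poly to_ac p) > 0"
    by (simp add: degree_map_poly_to_ac)
  then show thesis
    using alg_closed_imp_poly_has_root that unfolding eval_ac_def by blast
qed

text \<open>
  Euclidean division by a nonzero polynomial of least degree that vanishes at \<open>x\<close> shows that it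
  divides everything vanishing at \<open>x\<close>; an irreducible such polynomial is associated to it.
\<close>
lemma irreducible_dvd_if_common_root:
  fixes p h :: "'a::field poly"
  assumes "irreducible p" and "eval_ac p x = 0" and "eval_ac h x = 0"
  shows "p dvd h"
proof -
  define ann where "ann f \<longleftrightarrow> f \<noteq> 0 \<and> eval_ac f x = 0" for f :: "'a poly"
  have "ann p"
    using assms by (auto simp: ann_def)
  then obtain d where d: "ann d" and least: "\<And>f. ann f \<Longrightarrow> degree d \<le> degree f"
    using ex_has_least_nat[of ann p degree] by blast
  have dvd: "d dvd f" if "eval_ac f x = 0" for f
  proof (rule ccontr)
    assume "\<not> d dvd f"
    then have nz: "f mod d \<noteq> 0"
      by (simp add: mod_eq_0_iff_dvd)
    have "f mod d = f - d * (f div d)"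
      by (simp add: minus_mult_div_eq_mod)
    then have "ann (f mod d)"
      using nz that d by (simp add: ann_def)
    moreover have "degree (f mod d) < degree d"
      using d nz degree_mod_less[of d f] by (auto simp: ann_def)
    ultimately show False
      using least by fastforce
  qed
  then obtain k where k: "p = d * k"
    using assms(2) by blast
  have "\<not> is_unit d"
  proof
    assume "is_unit d"
    then obtain a where "d = [:a:]"
      by (auto simp: is_unit_poly_iff)
    with d show False
      by (simp add: ann_def)
  qed
  then have "is_unit k"
    using irreducibleD[OF assms(1) k] by blast
  then have "p dvd d"
    using k by simp
  then show ?thesis
    using dvd assms(3) dvd_trans by blast
qed

text \<open>
  Together with the next lemma this bounds the degree of \<open>p\<close> from below: conjugates of a root are
  roots, and a period \<open>n\<close> is least once no \<open>n div p\<close> with \<open>p\<close> prime is a period.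
\<close>
lemma period_le_degree:
  fixes p :: "'a::{finite,field} poly"
  assumes "p \<noteq> 0" and "eval_ac p x = 0" and "inj_on (\<lambda>k. (frob ^^ k) x) {..<n}"
  shows "n \<le> degree p"
proof -
  have "eval_ac p ((frob ^^ k) x) = 0" for k
    by (induction k) (simp_all add: assms(2) flip: frob_eval_ac)
  then have sub: "(\<lambda>k. (frob ^^ k) x) ` {..<n} \<subseteq> {z. poly (map_poly to_ac p) z = 0}"
    by (auto simp: eval_ac_def)
  have nz: "map_poly to_ac p \<noteq> 0"
    using assms(1) by (simp add: map_poly_eq_0_iff)
  have "n = card ((\<lambda>k. (frob ^^ k) x) ` {..<n})"
    by (simp add: card_image assms(3))
  also have "\<dots> \<le> card {z. poly (map_poly to_ac p) z = 0}"
    by (intro card_mono poly_roots_finite nz sub)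
  also have "\<dots> \<le> degree p"
    using card_poly_roots_bound[OF nz] by (simp add: degree_map_poly_to_ac)
  finally show ?thesis .
qed

text \<open>
  If \<open>f\<close> identified two of the points, their distance \<open>e\<close> would be a period, and so would
  \<open>gcd e n\<close>; a prime factor of \<open>n div gcd e n\<close> then contradicts the hypothesis.
\<close>
lemma inj_on_funpow_orbit:
  fixes f :: "'b \<Rightarrow> 'b"
  assumes "inj f" and per: "(f ^^ n) x = x"
    and prime: "\<And>p. prime p \<Longrightarrow> p dvd n \<Longrightarrow> (f ^^ (n div p)) x \<noteq> x"
  shows "inj_on (\<lambda>k. (f ^^ k) x) {..<n}"
proof (rule linorder_inj_onI)
  fix i j assume "i < j" "i \<in> {..<n}" "j \<in> {..<n}"
  define e where "e = j - i"
  have e: "0 < e" "e < n" "j = i + e"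
    using \<open>i < j\<close> \<open>j \<in> {..<n}\<close> by (auto simp: e_def)
  have mult: "(f ^^ (k * m)) x = x" if "(f ^^ m) x = x" for k m
    by (induction k) (simp_all add: funpow_add that)
  show "(f ^^ i) x \<noteq> (f ^^ j) x"
  proof
    assume "(f ^^ i) x = (f ^^ j) x"
    also have "\<dots> = (f ^^ i) ((f ^^ e) x)"
      by (simp add: e(3) funpow_add)
    finally have fe: "(f ^^ e) x = x"
      using inj_fn[OF \<open>inj f\<close>, of i] by (simp add: inj_eq)
    define g where "g = gcd e n"
    obtain u v where uv: "e * u = n * v + g"
      using bezout_nat[of e n] e unfolding g_def by auto
    have "(f ^^ g) x = (f ^^ (g + v * n)) x"
      using mult[OF per, of v] by (simp add: funpow_add)
    also have "g + v * n = u * e"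
      using uv by (simp add: mult.commute)
    finally have fg: "(f ^^ g) x = x"
      using mult[OF fe] by simp
    have "g dvd n" "g \<le> e"
      using e(1) by (simp_all add: g_def)
    then have "g dvd n" "g < n"
      using e(2) by simp_all
    then obtain k where k: "n = g * k" "k \<noteq> 1"
      by (auto elim: dvdE)
    then obtain p where p: "prime p" "p dvd k"
      using prime_factor_nat by blast
    then obtain l where l: "k = p * l"
      by blast
    have "n div p = l * g"
      using k l p by (simp add: prime_gt_0_nat)
    then show False
      using mult[OF fg, of l] prime[of p] p k(1) by auto
  qed
qed auto

section \<open>Rotation identities\<close>

text \<open>
  The Chebyshev polynomial \<open>T\<^sub>5\<close>, which takes \<open>cos t\<close> to \<open>cos (5 t)\<close>.
\<close>
definition cheb5 :: "'a::comm_ring_1 \<Rightarrow> 'a"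
  where "cheb5 x = 16 * x ^ 5 - 20 * x ^ 3 + 5 * x"

text \<open>
  In this section \<open>y\<close> and \<open>y'\<close> stand for a root and its Frobenius image, \<open>a\<close> for \<open>y ^ n\<close> and \<open>b\<close> for
  \<open>(1 - y) ^ n\<close>. Substituting \<open>b = s - a\<close> into the second hypothesis makes \<open>a\<^sup>2\<close> cancel
  and leaves an equation linear in \<open>a\<close>.
\<close>
lemma root_pair_linear:
  fixes y y' a b s c :: "'k::field"
  assumes "a\<^sup>2 = y * y'" "b\<^sup>2 = (1 - y) * (1 - y')" "a + b = s" "1 - s\<^sup>2 = c"
  shows "2 * s * a = y + y' - c"
  using assms by Groebner_Basis.algebra

text \<open>
  In terms of \<open>cos t = 2 y - 1\<close> and \<open>cos t' = 2 y' - 1\<close> this conic says that \<open>t' - t\<close> or \<open>t' + t\<close>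
  is an angle with cosine \<open>1 - 2 c\<close>.
\<close>
lemma root_pair_conic:
  fixes y y' a s c :: "'k::field"
  assumes "2 * s * a = y + y' - c" "a\<^sup>2 = y * y'" "1 - s\<^sup>2 = c"
  shows "(y + y' - c)\<^sup>2 = 4 * (1 - c) * (y * y')"
  using assms by Groebner_Basis.algebra

text \<open>
  The equation for \<open>c\<close> says that \<open>2 - 4 c\<close>, twice the cosine of the rotation angle, is a root of
  \<open>t\<^sup>2 = t + 1\<close>. So that angle is 36 or 108 degrees, and five times it is an odd
  multiple of 180 degrees.
\<close>
lemma cheb5_conic:
  fixes y y' c :: "'k::field"
  assumes "(y + y' - c)\<^sup>2 = 4 * (1 - c) * (y * y')" "16 * c\<^sup>2 - 12 * c + 1 = 0"
  shows "cheb5 (2 * y' - 1) = - cheb5 (2 * y - 1)"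
proof -
  define x where "x = 2 * y - 1"
  define x' where "x' = 2 * y' - 1"
  define t where "t = 2 - 4 * c"
  have t: "t\<^sup>2 = t + 1"
    using assms(2) unfolding t_def by Groebner_Basis.algebra
  have conic: "4 * x\<^sup>2 + 4 * x'\<^sup>2 - 4 * t * x * x' - (3 - t) = 0"
    using assms unfolding x_def x'_def t_def by Groebner_Basis.algebra
  \<comment> \<open>The value \<open>t\<close> is one of \<open>2 cos 36\<close> and \<open>2 cos 108\<close> (in degrees), and \<open>1 - t\<close> is the other.
    \<open>T\<^sub>5 x + T\<^sub>5 x'\<close> vanishes iff five times the angles differ by an odd multiple of 180 degrees
    (up to sign), that is, iff the angles differ by 180, 36 or 108 degrees: one factor for each.\<close>
  have "cheb5 x + cheb5 x' = (x + x') * (4 * x\<^sup>2 + 4 * x'\<^sup>2 - 4 * t * x * x' - (3 - t)) *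
      (4 * x\<^sup>2 + 4 * x'\<^sup>2 - 4 * (1 - t) * x * x' - (2 + t))"
    using t unfolding cheb5_def by Groebner_Basis.algebra
  then have "cheb5 x + cheb5 x' = 0"
    by (simp only: conic mult_zero_right mult_zero_left)
  then show ?thesis
    by (simp add: x_def x'_def add_eq_0_iff)
qed

text \<open>
  Both \<open>y\<close> and \<open>y''\<close> are roots of the quadratic equation in the second variable that the conic
  imposes on the partners of \<open>y'\<close>; if they differ, their sum is read off its linear coefficient.
\<close>
lemma conic_step:
  fixes y y' y'' c :: "'k::field"
  assumes "(y + y' - c)\<^sup>2 = 4 * (1 - c) * (y * y')" "(y' + y'' - c)\<^sup>2 = 4 * (1 - c) * (y' * y'')"
    and "y'' \<noteq> y"
  shows "2 * y'' - 1 = (2 - 4 * c) * (2 * y' - 1) - (2 * y - 1)"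
proof -
  have "(y'' - y) * (2 * y'' - 1 - ((2 - 4 * c) * (2 * y' - 1) - (2 * y - 1))) = 0"
    using assms(1,2) by Groebner_Basis.algebra
  with assms(3) show ?thesis
    by (metis eq_iff_diff_eq_0 mult_eq_0_iff)
qed

text \<open>
  The characteristic polynomial \<open>X\<^sup>2 - t X + 1\<close> divides \<open>X ^ 5 + 1\<close> for either root \<open>t\<close> of
  \<open>t\<^sup>2 = t + 1\<close>.
\<close>
lemma golden_recurrence_antiperiod:
  fixes x :: "nat \<Rightarrow> 'k::idom"
  assumes t: "t\<^sup>2 = t + 1" and rec: "\<And>k. x (Suc (Suc k)) = t * x (Suc k) - x k"
  shows "x (k + 5) = - x k"
proof -
  define a b where "a = x k" and "b = x (Suc k)"
  have 2: "x (k + 2) = t * b - a"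
    using rec[of k] by (simp add: a_def b_def)
  have "x (k + 3) = t * x (k + 2) - b"
    using rec[of "k + 1"] by (simp add: b_def eval_nat_numeral)
  then have 3: "x (k + 3) = t * b - t * a"
    using t 2 by Groebner_Basis.algebra
  have "x (k + 4) = t * x (k + 3) - x (k + 2)"
    using rec[of "k + 2"] by (simp add: eval_nat_numeral)
  then have 4: "x (k + 4) = b - t * a"
    using t 2 3 by Groebner_Basis.algebra
  have "x (k + 5) = t * x (k + 4) - x (k + 3)"
    using rec[of "k + 3"] by (simp add: eval_nat_numeral)
  then have "x (k + 5) = - a"
    using t 3 4 by Groebner_Basis.algebra
  then show ?thesis
    by (simp add: a_def)
qed

text \<open>
  The element \<open>w\<close> plays the role of \<open>u v\<close> for square roots \<open>u\<close>, \<open>v\<close> of \<open>y\<close> and \<open>1 - y\<close>, and \<open>w'\<close> that of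
  \<open>u' v'\<close>. Here the same \<open>a\<close> occurs in the equations for \<open>w\<close> and for \<open>w'\<close>, which is the
  situation of a root fixed by the second Frobenius iterate. Multiplying those two equations gives
  \<open>c (a b)\<close> on one side and \<open>- c (a b)\<close> on the other.
\<close>
lemma period_two_obstruction:
  fixes y y' a b s c e w w' :: "'k::field"
  assumes "a\<^sup>2 = y * y'" "b\<^sup>2 = (1 - y) * (1 - y')" "a + b = s" "1 - s\<^sup>2 = c"
    and "w * w' = a * b" "e * w = y * s - a" "e * w' = y' * s - a" "e\<^sup>2 = c"
  shows "2 * c * (a * b) = 0"
  using assms by Groebner_Basis.algebra

text \<open>
  The right-hand sides of the hypotheses are \<open>2 ^ 18\<close> times the coefficients in the theorem: \<open>T\<^sub>5 (2 y - 1)\<close> has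
  leading coefficient \<open>2 ^ 9\<close> and takes the value \<open>-1\<close> at \<open>y = 0\<close>.
\<close>
lemma expand_cheb5_square:
  fixes y :: "'k::field"
  assumes "262144 * a1 = - 100" "262144 * a2 = 3300" "262144 * a3 = - 42240" "262144 * a4 = 274560"
    "262144 * a5 = - 1025024" "262144 * a6 = 2329600" "262144 * a7 = - 3276800" "262144 * a8 = 2785280"
  shows "262144 * (y * (a1 + y * (a2 + y * (a3 + y * (a4 + y * (a5 + y * (a6 + y * (a7 + y * (a8 + y * (- 5 + y))))))))))
    = cheb5 (2 * y - 1) ^ 2 - 1"
  using assms unfolding cheb5_def by Groebner_Basis.algebra

section \<open>The square roots in the base field\<close>

lemma of_nat_CARD_mod_eq_0:
  assumes "CARD('a::{finite,field}) mod d = i" and "of_nat d = (0::'a)"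
  shows "of_nat i = (0::'a)"
proof -
  have "CARD('a) = d * (CARD('a) div d) + i"
    using assms(1) mult_div_mod_eq[of d "CARD('a)"] by metis
  then have "of_nat CARD('a) = of_nat d * of_nat (CARD('a) div d) + (of_nat i :: 'a)"
    by (metis of_nat_add of_nat_mult)
  then show ?thesis
    by (simp add: of_nat_CARD_eq_0 assms(2))
qed

lemma two_neq_0:
  assumes "odd CARD('a::{finite,field})"
  shows "(2::'a) \<noteq> 0"
proof
  assume "(2::'a) = 0"
  then have "of_nat 1 = (0::'a)"
    using assms
    by - (rule of_nat_CARD_mod_eq_0[of 2 1], auto simp: odd_iff_mod_2_eq_one)
  then show False
    by simp
qed

lemma five_neq_0:
  assumes "CARD('a::{finite,field}) mod 5 = 1 \<or> CARD('a) mod 5 = 4"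
  shows "(5::'a) \<noteq> 0"
proof
  assume 5: "(5::'a) = 0"
  from assms have "of_nat 1 = (0::'a) \<or> of_nat 4 = (0::'a)"
    using of_nat_CARD_mod_eq_0[of 5] 5 by force
  moreover have "(4::'a) = 5 - 1"
    by simp
  ultimately show False
    using 5 by simp
qed

lemma cyclotomic_20_root_power:
  fixes z :: "'k::field"
  assumes "z ^ 8 - z ^ 6 + z ^ 4 - z ^ 2 + 1 = 0"
  shows "z ^ 20 = 1"
  using assms by Groebner_Basis.algebra

text \<open>
  Dividing the cyclotomic equation by \<open>z ^ 4\<close> makes it symmetric in \<open>z\<close> and \<open>w = 1 / z\<close>.
\<close>
lemma cyclotomic_20_root_plus_inverse:
  fixes z w :: "'k::field"
  assumes "z * w = 1" "z ^ 8 - z ^ 6 + z ^ 4 - z ^ 2 + 1 = 0"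
  shows "(z + w) ^ 4 - 5 * (z + w)\<^sup>2 + 5 = 0"
proof -
  have "z ^ 4 * ((z + w) ^ 4 - 5 * (z + w)\<^sup>2 + 5) = 0"
    using assms by Groebner_Basis.algebra
  with assms(1) show ?thesis by auto
qed

text \<open>
  A root \<open>z\<close> of the cyclotomic polynomial satisfies \<open>z ^ 20 = 1\<close>, so its \<open>q\<close>-th power is \<open>z\<close> or
  \<open>1 / z\<close>, and \<open>b = z + 1 / z\<close> is fixed by the Frobenius map. In characteristic 0, \<open>b\<close> would be
  twice the cosine of an odd multiple of 18 degrees.
\<close>
lemma sqrt5_and_cos18:
  assumes "CARD('a::{finite,field}) mod 20 = 1 \<or> CARD('a) mod 20 = 19"
  obtains r b :: "'a::{finite,field}" where "r\<^sup>2 = 5" and "5 + r = 2 * b\<^sup>2"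
proof -
  \<comment> \<open>The cyclotomic polynomial of index 20.\<close>
  define \<Phi> :: "'a alg_closure poly" where "\<Phi> = [:1, 0, -1, 0, 1, 0, -1, 0, 1:]"
  have "degree \<Phi> > 0"
    by (simp add: \<Phi>_def)
  then obtain z where "poly \<Phi> z = 0"
    using alg_closed_imp_poly_has_root by blast
  then have z: "z ^ 8 - z ^ 6 + z ^ 4 - z ^ 2 + 1 = 0"
    unfolding \<Phi>_def by simp Groebner_Basis.algebra
  then have z20: "z ^ 20 = 1"
    by (rule cyclotomic_20_root_power)
  define w where "w = z ^ 19"
  have zw: "z * w = 1"
    using z20 by (simp add: w_def flip: power_Suc)
  define k where "k = CARD('a) div 20"
  have pow: "frob z = z ^ (CARD('a) mod 20)"
  proof -
    have "frob z = z ^ (20 * k + CARD('a) mod 20)"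
      by (simp add: frob_def k_def)
    also have "\<dots> = (z ^ 20) ^ k * z ^ (CARD('a) mod 20)"
      by (simp only: power_add power_mult)
    finally show ?thesis
      by (simp add: z20)
  qed
  have zw': "frob z * frob w = 1"
    using zw by (metis frob_mult frob_1)
  have "frob z = z \<or> frob z = w"
    using pow assms by (auto simp: w_def)
  then have "frob (z + w) = z + w"
  proof
    assume "frob z = z"
    with zw zw' have "frob w = w"
      by Groebner_Basis.algebra
    with \<open>frob z = z\<close> show ?thesis
      by simp
  next
    assume "frob z = w"
    with zw zw' have "frob w = z"
      by Groebner_Basis.algebra
    with \<open>frob z = w\<close> show ?thesis
      by simp
  qed
  then obtain b where b: "z + w = to_ac b"
    using frob_fixed_imp_base_field by blast
  have "to_ac (b ^ 4 - 5 * b\<^sup>2 + 5) = 0"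
    using cyclotomic_20_root_plus_inverse[OF zw z] by (simp add: b)
  then have "b ^ 4 - 5 * b\<^sup>2 + 5 = 0"
    by (simp only: to_ac_eq_0_iff)
  then have "(2 * b\<^sup>2 - 5)\<^sup>2 = 5"
    by Groebner_Basis.algebra
  then show thesis
    by (rule that[of "2 * b\<^sup>2 - 5" b]) simp
qed

text \<open>
  As \<open>8 (1 - c) = 5 + r\<close>, the lemma \<open>sqrt5_and_cos18\<close> settles the matter for one of the two square
  roots of 5; the other follows because the product \<open>(5 + r) (5 - r) = 20 = 4 r\<^sup>2\<close> is a square.
\<close>
lemma cos18_square:
  fixes r c :: "'a::{finite,field}"
  assumes mod20: "CARD('a) mod 20 = 1 \<or> CARD('a) mod 20 = 19"
    and r: "r\<^sup>2 = 5" and c8: "8 * c = 3 - r"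
  shows "\<exists>d. d\<^sup>2 = 1 - c"
proof -
  obtain r0 b :: 'a where r0: "r0\<^sup>2 = 5" and b: "5 + r0 = 2 * b\<^sup>2"
    using sqrt5_and_cos18[OF mod20] by blast
  have odd: "odd CARD('a)" and mod5: "CARD('a) mod 5 = 1 \<or> CARD('a) mod 5 = 4"
    using mod20 by presburger+
  have two: "(2::'a) \<noteq> 0" and five: "(5::'a) \<noteq> 0"
    using two_neq_0[OF odd] five_neq_0[OF mod5] by auto
  have pow2: "(4::'a) \<noteq> 0" "(8::'a) \<noteq> 0" "(16::'a) \<noteq> 0"
    using power_not_zero[OF two, of 2] power_not_zero[OF two, of 3] power_not_zero[OF two, of 4]
    by simp_all
  consider "r = r0" | "r = - r0"
    using r r0 power2_eq_iff[of r r0] by auto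
  then show ?thesis
  proof cases
    case 1
    define d where "d = b / 2"
    have d: "2 * d = b"
      using two by (simp add: d_def)
    have "8 * d\<^sup>2 = 2 * (2 * d)\<^sup>2"
      by (simp add: power2_eq_square)
    also have "\<dots> = 8 * (1 - c)"
      using b c8 1 unfolding d by (simp add: right_diff_distrib)
    finally have "8 * d\<^sup>2 = 8 * (1 - c)" .
    then show ?thesis
      using pow2(2) by (metis mult_left_cancel)
  next
    case 2
    have "b \<noteq> 0"
    proof
      assume "b = 0"
      then have "r0 = - 5"
        using b by Groebner_Basis.algebra
      then have "25 = (5::'a)"
        using r0 by simp
      moreover have "4 * 5 = (25 - 5 :: 'a)"
        by simp
      ultimately have "4 * 5 = (0::'a)"
        by simp
      with pow2 five show False
        unfolding mult_eq_0_iff by blast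
    qed
    define d where "d = r0 / (2 * b)"
    have d: "2 * b * d = r0"
      using \<open>b \<noteq> 0\<close> two by (simp add: d_def)
    have c1: "8 * (1 - c) = 5 - r0"
      using c8 2 by (simp add: right_diff_distrib)
    have "(16 * b\<^sup>2) * d\<^sup>2 = 4 * (2 * b * d)\<^sup>2"
      by (simp add: power2_eq_square)
    also have "\<dots> = 25 - r0\<^sup>2"
      unfolding d by (simp add: r0)
    also have "\<dots> = (5 + r0) * (5 - r0)"
      by (simp add: power2_eq_square algebra_simps)
    also have "\<dots> = (16 * b\<^sup>2) * (1 - c)"
      unfolding b by (simp flip: c1)
    finally have "(16 * b\<^sup>2) * d\<^sup>2 = (16 * b\<^sup>2) * (1 - c)" .
    moreover have "16 * b\<^sup>2 \<noteq> 0"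
      using pow2 \<open>b \<noteq> 0\<close> by simp
    ultimately show ?thesis
      by (metis mult_left_cancel)
  qed
qed

section \<open>The Frobenius orbit of a root\<close>

text \<open>
  The two facts on which the theorem rests: the Frobenius map acts on \<open>T\<^sub>5 (2 y - 1)\<close> as a sign
  change, and the root has ten distinct conjugates. A period 5 of the orbit would contradict the
  antiperiod 5 of \<open>x k = 2 y\<^sub>k - 1\<close>, since \<open>x 0\<close> is not zero.
\<close>
lemma root_orbit:
  fixes y :: "'a::{finite,field} alg_closure" and s c e :: "'a::{finite,field}"
  assumes n: "CARD('a) + 1 = 2 * n" and two: "(2::'a) \<noteq> 0"
    and sc: "1 - s\<^sup>2 = c" and c: "16 * c\<^sup>2 - 12 * c + 1 = 0" and e: "e\<^sup>2 = c"
    and nz: "s \<noteq> 0" "c \<noteq> 0"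
    and root: "y ^ n + (1 - y) ^ n = to_ac s"
  shows "frob (cheb5 (2 * y - 1)) = - cheb5 (2 * y - 1)"
    and "inj_on (\<lambda>k. (frob ^^ k) y) {..<10}"
proof -
  define S C E where "S = to_ac s" and "C = to_ac c" and "E = to_ac e"
  have SC: "1 - S\<^sup>2 = C" "16 * C\<^sup>2 - 12 * C + 1 = 0" "E\<^sup>2 = C"
    unfolding S_def C_def E_def using sc c e
    by (simp_all flip: to_ac_power to_ac_numeral to_ac_1 to_ac_0 to_ac_diff to_ac_mult to_ac_add)
  have nz': "S \<noteq> 0" "C \<noteq> 0" "E \<noteq> 0" "(2::'a alg_closure) \<noteq> 0"
    using nz e two by (auto simp: S_def C_def E_def simp flip: to_ac_numeral)
  have fixed: "frob S = S" "frob C = C" "frob E = E"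
    by (simp_all add: S_def C_def E_def)
  have sq: "(x ^ n)\<^sup>2 = x * frob x" for x :: "'a alg_closure"
  proof -
    have "(x ^ n)\<^sup>2 = x ^ (CARD('a) + 1)"
      unfolding n by (simp add: power_mult[symmetric] mult.commute)
    then show ?thesis
      by (simp add: frob_def)
  qed
  define a b where "a = y ^ n" and "b = (1 - y) ^ n"
  have a: "a\<^sup>2 = y * frob y" and b: "b\<^sup>2 = (1 - y) * (1 - frob y)" and ab: "a + b = S"
    using sq[of y] sq[of "1 - y"] root by (simp_all add: a_def b_def S_def)
  have lin: "2 * S * a = y + frob y - C"
    by (rule root_pair_linear[OF a b ab SC(1)])
  have conic: "(y + frob y - C)\<^sup>2 = 4 * (1 - C) * (y * frob y)"
    by (rule root_pair_conic[OF lin a SC(1)])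
  have "cheb5 (2 * frob y - 1) = - cheb5 (2 * y - 1)"
    by (rule cheb5_conic[OF conic SC(2)])
  then show "frob (cheb5 (2 * y - 1)) = - cheb5 (2 * y - 1)"
    by (simp add: cheb5_def)

  have period2: "frob (frob y) \<noteq> y"
  proof
    assume per: "frob (frob y) = y"
    have "frob (2 * S * a) = 2 * S * a"
      unfolding lin by (simp add: fixed per add.commute)
    then have "frob a = a"
      using nz' by (simp add: fixed)
    \<comment> \<open>By the linear relation \<open>lin\<close>, \<open>(y S - a)\<^sup>2 = C (y (1 - y))\<close>. As the square root \<open>E\<close> of \<open>C\<close> lies
      in the base field, this gives a square root \<open>w\<close> of \<open>y (1 - y)\<close> with a known Frobenius image.\<close>
    define w where "w = (y * S - a) / E"
    have Ew: "E * w = y * S - a" and Ew': "E * frob w = frob y * S - a"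
      using nz' by (simp_all add: w_def fixed \<open>frob a = a\<close>)
    have "E\<^sup>2 * w\<^sup>2 = E\<^sup>2 * (y * (1 - y))"
      using Ew lin a SC(1,3) by Groebner_Basis.algebra
    then have "w\<^sup>2 = y * (1 - y)"
      using nz' by simp
    then have "w * frob w = a * b"
      using sq[of w] unfolding a_def b_def by (metis power_mult power_mult_distrib mult.commute)
    then have "2 * C * (a * b) = 0"
      using period_two_obstruction[OF a b ab SC(1) _ Ew Ew' SC(3)] by blast
    then have "y = 0 \<or> y = 1"
      using nz' by (auto simp: a_def b_def)
    then have "S = 1"
      using ab n by (auto simp: a_def b_def power_0_left)
    with SC(1) nz' show False
      by simp
  qed

  define x where "x k = 2 * (frob ^^ k) y - 1" for k
  have conic_k: "((frob ^^ k) y + (frob ^^ Suc k) y - C)\<^sup>2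
      = 4 * (1 - C) * ((frob ^^ k) y * (frob ^^ Suc k) y)" for k
  proof (induction k)
    case 0
    show ?case using conic by simp
  next
    case (Suc k)
    from arg_cong[OF this, of frob] show ?case
      by (simp add: fixed)
  qed
  have rec: "x (Suc (Suc k)) = (2 - 4 * C) * x (Suc k) - x k" for k
  proof -
    have "(frob ^^ Suc (Suc k)) y = (frob ^^ k) (frob (frob y))"
      by (simp add: funpow_swap1)
    then have "(frob ^^ Suc (Suc k)) y \<noteq> (frob ^^ k) y"
      using period2 inj_eq[OF inj_fn[OF inj_frob]] by metis
    from conic_step[OF conic_k conic_k this] show ?thesis
      by (simp add: x_def)
  qed
  have "(2 - 4 * C)\<^sup>2 = (2 - 4 * C) + 1"
    using SC(2) by Groebner_Basis.algebra
  note anti = golden_recurrence_antiperiod[OF this, of x, OF rec]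
  have x0: "x 0 \<noteq> 0"
  proof
    assume "x 0 = 0"
    then have "2 * y = 1"
      by (simp add: x_def)
    moreover from arg_cong[OF this, of frob] have "2 * frob y = 1"
      by simp
    ultimately have "2 * (2 * (C * S\<^sup>2)) = 0"
      using conic SC(1) by Groebner_Basis.algebra
    then show False
      using nz' by (metis mult_eq_0_iff power_not_zero)
  qed
  show "inj_on (\<lambda>k. (frob ^^ k) y) {..<10}"
  proof (rule inj_on_funpow_orbit[OF inj_frob])
    have "x 10 = x 0"
      using anti[of 0] anti[of 5] by simp
    then show "(frob ^^ 10) y = y"
      using nz' by (simp add: x_def)
  next
    fix p :: nat assume "prime p" "p dvd 10"
    then have "p dvd 2 * 5"
      by simp
    then have "p dvd 2 \<or> p dvd 5"
      using \<open>prime p\<close> prime_dvd_mult_iff by blast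
    then have "p = 2 \<or> p = 5"
      using \<open>prime p\<close> primes_dvd_imp_eq[of p 2] primes_dvd_imp_eq[of p 5] by auto
    then show "(frob ^^ (10 div p)) y \<noteq> y"
    proof
      assume "p = 2"
      have "x 5 \<noteq> x 0"
      proof
        assume "x 5 = x 0"
        then have "x 0 + x 0 = 0"
          using anti[of 0] by simp
        then have "2 * x 0 = 0"
          by (simp only: mult_2)
        with x0 nz' show False
          by simp
      qed
      with \<open>p = 2\<close> show ?thesis
        by (auto simp: x_def)
    next
      assume "p = 5"
      then have "10 div p = Suc (Suc 0)"
        by simp
      then show ?thesis
        using period2 by simp
    qed
  qed
qed

theorem corollary4p11:
  assumes "[int CARD('a::{finite,field}) = 1] (mod 20) \<or> [int CARD('a) = -1] (mod 20)"
  shows "(\<exists>r::'a. r\<^sup>2 = 5) \<and>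
    (\<forall>r c::'a. r\<^sup>2 = 5 \<and> c = (3 - r) / 8 \<longrightarrow>
      c \<in> C_set \<and>
      (\<forall>s. 1 - s\<^sup>2 = c \<longrightarrow>
        (\<forall>I. lead_coeff I = 1 \<and> irreducible I \<and> I dvd g_poly s \<longrightarrow>
          (\<exists>m. I = [:- m, - 25/65536, 825/65536, - 165/1024, 2145/2048, - 1001/256,
                    2275/256, - 25/2, 85/8, - 5, 1:]))))"
proof -
  have mod20: "CARD('a) mod 20 = 1 \<or> CARD('a) mod 20 = 19"
  proof -
    have "int (CARD('a) mod 20) = int 1 \<or> int (CARD('a) mod 20) = int 19"
      using assms by (simp add: cong_def zmod_int)
    then show ?thesis
      by (simp only: of_nat_eq_iff)
  qed
  have odd: "odd CARD('a)" and mod5: "CARD('a) mod 5 = 1 \<or> CARD('a) mod 5 = 4"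
    using mod20 by presburger+
  have two: "(2::'a) \<noteq> 0" and five: "(5::'a) \<noteq> 0"
    using two_neq_0[OF odd] five_neq_0[OF mod5] by auto
  have pow2: "(4::'a) \<noteq> 0" "(8::'a) \<noteq> 0" "(16::'a) \<noteq> 0" "(256::'a) \<noteq> 0" "(1024::'a) \<noteq> 0"
    "(2048::'a) \<noteq> 0" "(65536::'a) \<noteq> 0" "(262144::'a) \<noteq> 0"
    using power_not_zero[OF two, of 2] power_not_zero[OF two, of 3] power_not_zero[OF two, of 4]
      power_not_zero[OF two, of 8] power_not_zero[OF two, of 10] power_not_zero[OF two, of 11]
      power_not_zero[OF two, of 16] power_not_zero[OF two, of 18]
    by simp_all
  have ex5: "\<exists>r::'a. r\<^sup>2 = 5"
    using sqrt5_and_cos18[OF mod20] by blast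
  define n where "n = (CARD('a) + 1) div 2"
  have n: "CARD('a) + 1 = 2 * n"
    using odd by (simp add: n_def)
  have main: "c \<in> C_set \<and>
      (\<forall>s. 1 - s\<^sup>2 = c \<longrightarrow>
        (\<forall>I. lead_coeff I = 1 \<and> irreducible I \<and> I dvd g_poly s \<longrightarrow>
          (\<exists>m. I = [:- m, - 25/65536, 825/65536, - 165/1024, 2145/2048, - 1001/256,
                    2275/256, - 25/2, 85/8, - 5, 1:])))"
    if r: "r\<^sup>2 = 5" and c_def: "c = (3 - r) / 8" for r c :: 'a
  proof -
    have c8: "8 * c = 3 - r"
      using pow2 by (simp add: c_def)
    have "4 * (16 * c\<^sup>2 - 12 * c + 1) = 0"
      using c8 r by Groebner_Basis.algebra
    then have c: "16 * c\<^sup>2 - 12 * c + 1 = 0"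
      using pow2(1) unfolding mult_eq_0_iff by blast
    \<comment> \<open>\<open>(r - 1)\<^sup>2 = 6 - 2 r = 16 c\<close>\<close>
    define e where "e = (r - 1) / 4"
    have "4 * e = r - 1"
      using pow2(1) by (simp add: e_def)
    then have "16 * e\<^sup>2 = 16 * c"
      using c8 r by Groebner_Basis.algebra
    then have e: "e\<^sup>2 = c"
      using pow2(3) by (metis mult_left_cancel)
    have c_nz: "c \<noteq> 0"
      using c by fastforce
    have c1_nz: "1 - c \<noteq> 0"
    proof
      assume "1 - c = 0"
      then have "c = 1"
        by simp
      then have "5 = (0::'a)"
        using c by simp
      with five show False ..
    qed
    have "\<exists>d. d\<^sup>2 = 1 - c"
      using cos18_square[OF mod20 r c8] .
    then have "c \<in> C_set"
      using e c_nz c1_nz by (auto simp: C_set_def quadratic_char_def)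
    moreover have "\<exists>m. I = [:- m, - 25/65536, 825/65536, - 165/1024, 2145/2048, - 1001/256,
                    2275/256, - 25/2, 85/8, - 5, 1:]"
      if sc: "1 - s\<^sup>2 = c" and monic: "lead_coeff I = 1" and irred: "irreducible I"
        and dvd: "I dvd g_poly s" for s I
    proof -
      have s_nz: "s \<noteq> 0"
        using sc c1_nz by auto
      obtain y where y: "eval_ac I y = 0"
        using irreducible_imp_root[OF irred] by blast
      obtain J where "g_poly s = I * J"
        using dvd by blast
      then have "eval_ac (g_poly s) y = 0"
        using y by simp
      then have root: "y ^ n + (1 - y) ^ n = to_ac s"
        by (simp add: g_poly_def Let_def n_def)
      note orbit = root_orbit[OF n two sc c e s_nz c_nz root]
      have "frob ((cheb5 (2 * y - 1))\<^sup>2) = (cheb5 (2 * y - 1))\<^sup>2"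
        using orbit(1) by simp
      then obtain t where t: "(cheb5 (2 * y - 1))\<^sup>2 = to_ac t"
        using frob_fixed_imp_base_field by blast
      define m where "m = (t - 1) / 262144"
      have m: "262144 * m = t - 1"
        using pow2 by (simp add: m_def)
      define P where "P = [:- m, - 25/65536, 825/65536, - 165/1024, 2145/2048, - 1001/256,
                    2275/256, - 25/2, 85/8, - 5, 1:]"
      have "262144 * eval_ac P y = (cheb5 (2 * y - 1))\<^sup>2 - 1 - to_ac (262144 * m)"
      proof -
        have scaled: "262144 * to_ac u = w" if "262144 * u = v" "to_ac v = w" for u v :: 'a and w
          using that by auto
        have coeffs: "262144 * (- 25/65536) = (- 100 :: 'a)" "262144 * (825/65536) = (3300 :: 'a)"
          "262144 * (- 165/1024) = (- 42240 :: 'a)" "262144 * (2145/2048) = (274560 :: 'a)"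
          "262144 * (- 1001/256) = (- 1025024 :: 'a)" "262144 * (2275/256) = (2329600 :: 'a)"
          "262144 * (- 25/2) = (- 3276800 :: 'a)" "262144 * (85/8) = (2785280 :: 'a)"
          using pow2 two by (simp_all add: field_simps)
        have "262144 * (y * (to_ac (- 25/65536) + y * (to_ac (825/65536) + y * (to_ac (- 165/1024) +
            y * (to_ac (2145/2048) + y * (to_ac (- 1001/256) + y * (to_ac (2275/256) +
            y * (to_ac (- 25/2) + y * (to_ac (85/8) + y * (- 5 + y))))))))))
          = cheb5 (2 * y - 1) ^ 2 - 1"
          by (rule expand_cheb5_square; rule scaled, rule coeffs, simp)
        moreover have "eval_ac P y = - to_ac m + y * (to_ac (- 25/65536) + y * (to_ac (825/65536) +
            y * (to_ac (- 165/1024) + y * (to_ac (2145/2048) + y * (to_ac (- 1001/256) +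
            y * (to_ac (2275/256) + y * (to_ac (- 25/2) + y * (to_ac (85/8) + y * (- 5 + y)))))))))"
          by (simp add: P_def)
        ultimately show ?thesis
          by (simp add: distrib_left)
      qed
      also have "\<dots> = 0"
        unfolding m by (simp add: t)
      finally have "eval_ac P y = 0"
        using pow2 by (metis mult_eq_0_iff to_ac_eq_0_iff to_ac_numeral)
      then obtain k where k: "P = I * k"
        using irreducible_dvd_if_common_root[OF irred y] by blast
      have deg: "degree P = 10" and lead: "lead_coeff P = 1"
        by (simp_all add: P_def)
      have "10 \<le> degree I"
        using irred by (intro period_le_degree[OF _ y orbit(2)]) auto
      moreover have "P \<noteq> 0"
        by (simp add: P_def)
      then have "10 = degree I + degree k"
        using deg k by (metis degree_mult_eq mult_eq_0_iff)
      ultimately have "degree k = 0"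
        by simp
      moreover have "lead_coeff k = 1"
        using lead monic unfolding k by (simp add: lead_coeff_mult)
      ultimately have "k = 1"
        by (metis degree_0_id one_pCons of_nat_1 degree_eq_zeroE coeff_pCons_0)
      then show ?thesis
        using k P_def by auto
    qed
    ultimately show ?thesis
      by blast
  qed
  then show ?thesis
    using ex5 by blast
qed

end
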